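(* Let $G$ be a finite simple connected graph with Ore-degree $\theta(G)\le 7$. If $\mathrm{mad}(G)<\frac{34}{11}$, then $\chi_s'(G)\le 13$.
   Context: For a graph $G=(V,E)$, the distance between two edges is their distance in the line graph of $G$; two distinct edges "see" each other if their distance is $1$ (they share an endpoint) or $2$ (they are not incident but some edge of $G$ is incident to both). A strong edge-coloring of $G$ is an assignment of colors to the edges such that any two edges that see each other receive distinct colors; the strong chromatic index $\chi_s'(G)$ is the minimum number of colors in a strong edge-coloring of $G$. The Ore-degree of $G$ is $\theta(G)=\max\{d(u)+d(v): uv\in E\}$, where $d(\cdot)$ denotes vertex degree. The maximum average degree of $G$ is $\mathrm{mad}(G)=\max\{\bar d(G'): G'\subseteq G\}$, where $\bar d(G')=2|E(G')|/|V(G')|$ is the average degree of the subgraph $G'$. *)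

theory Defs
  imports Complex_Main "HOL-Library.Extended_Nat"
begin

text \<open>A graph is given by its vertex set and its edge set; an edge is the two-element set of its
  endpoints.\<close>

definition simple_graph :: "'a set \<Rightarrow> 'a set set \<Rightarrow> bool" where
  "simple_graph V E \<longleftrightarrow> (\<forall>e\<in>E. e \<subseteq> V \<and> card e = 2)"

definition finite_simple_graph :: "'a set \<Rightarrow> 'a set set \<Rightarrow> bool" where
  "finite_simple_graph V E \<longleftrightarrow> simple_graph V E \<and> finite V"

definition adjacency :: "'a set set \<Rightarrow> ('a \<times> 'a) set" where
  "adjacency E = {(u, v). {u, v} \<in> E}"

text \<open>The null graph is not connected.\<close>

definition connected_graph :: "'a set \<Rightarrow> 'a set set \<Rightarrow> bool" where
  "connected_graph V E \<longleftrightarrow> V \<noteq> {} \<and> (\<forall>u\<in>V. \<forall>v\<in>V. (u, v) \<in> (adjacency E)\<^sup>*)"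

definition graph_dist :: "'a set set \<Rightarrow> 'a \<Rightarrow> 'a \<Rightarrow> enat" where
  "graph_dist E u v = (INF n\<in>{n. (u, v) \<in> adjacency E ^^ n}. enat n)"

definition vertex_degree :: "'a set set \<Rightarrow> 'a \<Rightarrow> nat" where
  "vertex_degree E v = card {e \<in> E. v \<in> e}"

text \<open>The Ore-degree of an edgeless graph is 0 by convention.\<close>

definition ore_degree :: "'a set set \<Rightarrow> nat" where
  "ore_degree E =
    (if E = {} then 0 else Max {vertex_degree E u + vertex_degree E v | u v. {u, v} \<in> E})"

definition is_subgraph :: "'a set \<Rightarrow> 'a set set \<Rightarrow> 'a set \<Rightarrow> 'a set set \<Rightarrow> bool" where
  "is_subgraph V' E' V E \<longleftrightarrow> simple_graph V' E' \<and> V' \<subseteq> V \<and> E' \<subseteq> E"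

definition avg_degree :: "'a set \<Rightarrow> 'a set set \<Rightarrow> real" where
  "avg_degree V E = 2 * real (card E) / real (card V)"

definition max_avg_degree :: "'a set \<Rightarrow> 'a set set \<Rightarrow> real" where
  "max_avg_degree V E = Max {avg_degree V' E' | V' E'. is_subgraph V' E' V E \<and> V' \<noteq> {}}"

text \<open>The vertex set of the line graph is the edge set of the graph itself.\<close>

definition line_graph_edges :: "'a set set \<Rightarrow> 'a set set set" where
  "line_graph_edges E = {{e, f} | e f. e \<in> E \<and> f \<in> E \<and> e \<noteq> f \<and> e \<inter> f \<noteq> {}}"

definition sees :: "'a set set \<Rightarrow> 'a set \<Rightarrow> 'a set \<Rightarrow> bool" where
  "sees E e f \<longleftrightarrow> e \<in> E \<and> f \<in> E \<and> graph_dist (line_graph_edges E) e f \<in> {1, 2}"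

definition strong_edge_coloring :: "'a set set \<Rightarrow> ('a set \<Rightarrow> nat) \<Rightarrow> bool" where
  "strong_edge_coloring E c \<longleftrightarrow> (\<forall>e\<in>E. \<forall>f\<in>E. sees E e f \<longrightarrow> c e \<noteq> c f)"

definition strong_chromatic_index :: "'a set set \<Rightarrow> nat" where
  "strong_chromatic_index E = (LEAST k. \<exists>c. strong_edge_coloring E c \<and> card (c ` E) = k)"

lemma adjacency_line_graph:
  "(e, f) \<in> adjacency (line_graph_edges E) \<longleftrightarrow> e \<in> E \<and> f \<in> E \<and> e \<noteq> f \<and> e \<inter> f \<noteq> {}"
  unfolding adjacency_def line_graph_edges_def by (auto simp: doubleton_eq_iff)

lemma graph_dist_eq_enat_iff:
  "graph_dist E u v = enat n \<longleftrightarrow>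
    (u, v) \<in> adjacency E ^^ n \<and> (\<forall>m<n. (u, v) \<notin> adjacency E ^^ m)"
proof -
  let ?S = "{n. (u, v) \<in> adjacency E ^^ n}"
  show ?thesis
  proof (cases "?S = {}")
    case True
    then show ?thesis by (auto simp: graph_dist_def top_enat_def)
  next
    case False
    define k where "k = (LEAST n. n \<in> ?S)"
    have k: "k \<in> ?S" "\<And>m. m \<in> ?S \<Longrightarrow> k \<le> m"
      using False by (auto simp: k_def intro: LeastI Least_le)
    have "graph_dist E u v = enat k"
      unfolding graph_dist_def by (rule antisym) (use k in \<open>auto intro!: INF_lower INF_greatest\<close>)
    then show ?thesis
      using k by (metis (mono_tags, lifting) enat.inject leD linorder_neqE_nat mem_Collect_eq)
  qed
qed

lemma sees_iff:
  assumes "e \<in> E" "f \<in> E"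
  shows "sees E e f \<longleftrightarrow> e \<noteq> f \<and> (e \<inter> f \<noteq> {} \<or> (\<exists>g\<in>E. g \<inter> e \<noteq> {} \<and> g \<inter> f \<noteq> {}))"
proof -
  let ?A = "adjacency (line_graph_edges E)"
  have d1: "graph_dist (line_graph_edges E) e f = 1 \<longleftrightarrow> e \<noteq> f \<and> (e, f) \<in> ?A"
    using graph_dist_eq_enat_iff[of "line_graph_edges E" e f 1] by (auto simp: one_enat_def)
  have "(\<forall>m<2. (e, f) \<notin> ?A ^^ m) \<longleftrightarrow> e \<noteq> f \<and> (e, f) \<notin> ?A"
    by (auto simp: numeral_2_eq_2 less_Suc_eq)
  then have d2: "graph_dist (line_graph_edges E) e f = 2 \<longleftrightarrow>
      e \<noteq> f \<and> (e, f) \<notin> ?A \<and> (e, f) \<in> ?A O ?A"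
    using graph_dist_eq_enat_iff[of "line_graph_edges E" e f 2]
    by (auto simp: numeral_eq_enat numeral_2_eq_2)
  have "(\<exists>g\<in>E. g \<inter> e \<noteq> {} \<and> g \<inter> f \<noteq> {}) \<longleftrightarrow> (e, f) \<in> ?A O ?A"
    if "e \<noteq> f" "e \<inter> f = {}"
    using that assms by (auto simp: adjacency_line_graph relcomp_unfold Int_commute)
  then show ?thesis
    unfolding sees_def using assms d1 d2 adjacency_line_graph[of e f E] by blast
qed

end

theory Submission
  imports Defs
begin

text \<open>In a minimal counterexample, deleting a nonempty vertex set leaves a colourable graph whose
  colouring stays valid in the whole graph, and an edge \<open>vw\<close> sees at most the sum of the degrees of the
  other neighbours of \<open>v\<close> and \<open>w\<close>. Deleting one vertex and extending greedily leaves only degrees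
  2, 3, 4 and 5, and every neighbour of a 2-vertex has degree at least 4. Around a 5-vertex, two
  edges can be given the same colour, which saves the one colour that the greedy extension lacks;
  so there are no 5-vertices, every neighbour of a 2-vertex is a 4-vertex, and the other neighbours of
  that 4-vertex are 3-vertices. A 3-vertex \<open>u\<close> without 4-neighbours is adjacent to a 3-vertex with two
  4-neighbours, or all its neighbours have exactly one 4-neighbour (\<open>u\<close> is needy); in the second case the
  same saving shows that a neighbour of \<open>u\<close> whose 4-neighbour is adjacent to a 2-vertex has no other
  needy neighbour. Discharging then gives average degree at least 34/11.\<close>

text \<open>Visibility is measured in all of \<open>E\<close> even when only \<open>F\<close> is
  coloured, so partial colourings extend edge by edge to a strong colouring of the whole graph with
  13 colours.\<close>

definition colors_on :: "'a set set \<Rightarrow> 'a set set \<Rightarrow> ('a set \<Rightarrow> nat) \<Rightarrow> bool" where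
  "colors_on E F c \<longleftrightarrow>
    (\<forall>e\<in>F. c e < 13) \<and> (\<forall>e\<in>F. \<forall>f\<in>F. sees E e f \<longrightarrow> c e \<noteq> c f)"

lemma sees_sym: "sees E e f \<longleftrightarrow> sees E f e"
proof (cases "e \<in> E \<and> f \<in> E")
  case True
  then show ?thesis by (auto simp: sees_iff)
next
  case False
  then show ?thesis by (auto simp: sees_def)
qed

section \<open>Neighbourhoods, incident edges and seen edges\<close>

locale fin_graph =
  fixes V :: "'a set" and E :: "'a set set"
  assumes fin_graph: "finite_simple_graph V E"
begin

abbreviation deg :: "'a \<Rightarrow> nat" where
  "deg \<equiv> vertex_degree E"

definition nb :: "'a \<Rightarrow> 'a set" where
  "nb v = {w. {v, w} \<in> E}"

definition inc :: "'a \<Rightarrow> 'a set set" where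
  "inc v = {e \<in> E. v \<in> e}"

definition seen :: "'a set \<Rightarrow> 'a set set" where
  "seen e = {f. sees E e f}"

text \<open>For an edge \<open>vw\<close> this bounds the number of edges that it sees through
  \<open>v\<close>; an edge between two of the summed neighbours is counted twice.\<close>

definition wt :: "'a \<Rightarrow> 'a \<Rightarrow> nat" where
  "wt v w = (\<Sum>x\<in>nb v - {w}. deg x)"

lemma finite_V: "finite V"
  using fin_graph by (simp add: finite_simple_graph_def)

lemma edge_in: "e \<in> E \<Longrightarrow> e \<subseteq> V" and edge_card: "e \<in> E \<Longrightarrow> card e = 2"
  using fin_graph by (auto simp: finite_simple_graph_def simple_graph_def)

lemma finite_E: "finite E"
  by (rule finite_subset[of _ "Pow V"]) (use edge_in finite_V in auto)

lemma edgeD: "{v, w} \<in> E \<Longrightarrow> v \<noteq> w \<and> v \<in> V \<and> w \<in> V"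
  using edge_in[of "{v, w}"] edge_card[of "{v, w}"] by auto

lemma edge_ex:
  assumes "e \<in> E" "v \<in> e"
  obtains w where "e = {v, w}"
proof -
  obtain a b where "e = {a, b}"
    using edge_card[OF assms(1)] by (auto simp: card_2_iff)
  with assms(2) that show ?thesis by (auto simp: insert_commute)
qed

lemma nb_iff: "w \<in> nb v \<longleftrightarrow> {v, w} \<in> E"
  by (simp add: nb_def)

lemma nb_sym: "w \<in> nb v \<longleftrightarrow> v \<in> nb w"
  by (simp add: nb_def insert_commute)

lemma nb_irrefl: "v \<notin> nb v"
  using edgeD[of v v] by (auto simp: nb_iff)

lemma nb_in_V: "w \<in> nb v \<Longrightarrow> v \<in> V \<and> w \<in> V"
  using edgeD by (auto simp: nb_iff)

lemma finite_nb: "finite (nb v)"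
  by (rule finite_subset[OF _ finite_V]) (use nb_in_V in auto)

lemma finite_inc: "finite (inc v)"
  using finite_E by (auto simp: inc_def)

lemma inc_eq_image: "inc v = (\<lambda>w. {v, w}) ` nb v"
proof (intro equalityI subsetI)
  fix e assume "e \<in> inc v"
  moreover from this obtain w where "e = {v, w}"
    using edge_ex[of e v] unfolding inc_def by blast
  ultimately show "e \<in> (\<lambda>w. {v, w}) ` nb v"
    by (auto simp: inc_def nb_iff)
qed (auto simp: inc_def nb_iff)

lemma card_inc: "card (inc v) = deg v"
  by (simp add: inc_def vertex_degree_def)

lemma card_nb: "card (nb v) = deg v"
proof -
  have "inj_on (\<lambda>w. {v, w}) (nb v)"
    by (auto simp: inj_on_def doubleton_eq_iff)
  then show ?thesis
    using card_inc[of v] by (simp add: inc_eq_image card_image)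
qed

lemma sum_deg: "(\<Sum>v\<in>V. deg v) = 2 * card E"
proof -
  have "(\<Sum>v\<in>V. deg v) = (\<Sum>v\<in>V. \<Sum>e\<in>E. of_bool (v \<in> e))"
    by (simp add: vertex_degree_def finite_E Int_def)
  also have "\<dots> = (\<Sum>e\<in>E. \<Sum>v\<in>V. of_bool (v \<in> e))"
    by (rule sum.swap)
  also have "\<dots> = (\<Sum>e\<in>E. 2)"
  proof (rule sum.cong[OF refl])
    fix e assume "e \<in> E"
    then have "V \<inter> e = e" "card e = 2"
      using edge_in edge_card by auto
    then show "(\<Sum>v\<in>V. of_bool (v \<in> e)) = (2::nat)"
      by (simp add: finite_V Int_def)
  qed
  finally show ?thesis by simp
qed

lemma seen_sub: "seen e \<subseteq> E"
  by (auto simp: seen_def sees_def)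

lemma finite_seen: "finite (seen e)"
  using finite_subset[OF seen_sub finite_E] .

lemma seen_irrefl: "e \<notin> seen e"
  using sees_iff[of e E e] by (auto simp: seen_def sees_def)

lemma seen_sym: "f \<in> seen e \<longleftrightarrow> e \<in> seen f"
  by (simp add: seen_def sees_sym)

text \<open>An edge incident to \<open>v\<close> or \<open>w\<close> is reached from its other end,
  any other seen edge from the far end of the joining edge. So each seen edge lies at a neighbour of
  \<open>v\<close> or \<open>w\<close> outside the pair, and can be counted by degrees.\<close>

lemma seen_edge:
  assumes "{v, w} \<in> E"
  shows "seen {v, w} = (\<Union>x\<in>nb v - {w}. inc x) \<union> (\<Union>x\<in>nb w - {v}. inc x)" (is "_ = ?R")
proof (intro equalityI subsetI)
  fix f assume "f \<in> seen {v, w}"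
  then have f: "f \<in> E" "f \<noteq> {v, w}"
    and s: "{v, w} \<inter> f \<noteq> {} \<or> (\<exists>g\<in>E. g \<inter> {v, w} \<noteq> {} \<and> g \<inter> f \<noteq> {})"
    using sees_iff[OF assms] seen_sub by (auto simp: seen_def sees_def)
  show "f \<in> ?R"
  proof (cases "{v, w} \<inter> f = {}")
    case False
    then obtain a b where ab: "f = {a, b}" "a = v \<or> a = w"
      using f(1) by (metis disjoint_iff edge_ex insert_iff singletonD)
    then have "b \<in> nb a" "f \<in> inc b" using f by (auto simp: inc_def nb_iff)
    moreover have "b \<noteq> w" if "a = v" using that ab f by auto
    moreover have "b \<noteq> v" if "a = w" using that ab f by (auto simp: insert_commute)
    ultimately show ?thesis using ab(2) by blast
  next
    case True
    with s obtain g a b where g: "g \<in> E" "a \<in> g" "b \<in> g" "a = v \<or> a = w" "b \<in> f"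
      by blast
    with True have ab: "a \<noteq> b" "b \<noteq> v" "b \<noteq> w" by auto
    then have "g = {a, b}"
      using edge_ex[OF g(1,2)] g(3) by auto
    then have "b \<in> nb a" "f \<in> inc b" using f g by (auto simp: inc_def nb_iff)
    then show ?thesis using ab g(4) by blast
  qed
next
  fix f assume "f \<in> ?R"
  then obtain x y where x: "y = v \<or> y = w" "{y, x} \<in> E" "x \<noteq> v" "x \<noteq> w" "f \<in> E" "x \<in> f"
    using edgeD by (auto simp: inc_def nb_iff) metis+
  then have "f \<noteq> {v, w}" by auto
  moreover have "{y, x} \<inter> {v, w} \<noteq> {}" "{y, x} \<inter> f \<noteq> {}" using x by auto
  ultimately show "f \<in> seen {v, w}"
    unfolding seen_def mem_Collect_eq sees_iff[OF assms x(5)]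
    by (intro conjI disjI2 bexI[OF _ x(2)]) auto
qed

lemma card_UN_inc: "card (\<Union>x\<in>nb v - {w}. inc x) \<le> wt v w"
  unfolding wt_def card_inc[symmetric] by (rule card_UN_le) (simp add: finite_nb)

lemma card_seen_le:
  assumes "{v, w} \<in> E"
  shows "card (seen {v, w}) \<le> wt v w + wt w v"
  unfolding seen_edge[OF assms]
  by (rule order_trans[OF card_Un_le add_mono[OF card_UN_inc card_UN_inc]])

text \<open>The edge \<open>ab\<close> closes a 4-cycle and is counted from both \<open>a\<close>
  and \<open>b\<close>, so the union bound loses at least one.\<close>

lemma card_seen_less:
  assumes "{v, w} \<in> E" "a \<in> nb v - {w}" "b \<in> nb w - {v}" "{a, b} \<in> E"
  shows "card (seen {v, w}) < wt v w + wt w v"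
proof -
  let ?A = "\<Union>x\<in>nb v - {w}. inc x" and ?B = "\<Union>x\<in>nb w - {v}. inc x"
  have fin: "finite ?A" "finite ?B" by (auto simp: finite_nb finite_inc)
  have "{a, b} \<in> ?A \<inter> ?B" using assms by (auto simp: inc_def)
  then have "card (?A \<inter> ?B) > 0" using fin by (auto simp: card_gt_0_iff)
  then show ?thesis
    using card_Un_Int[OF fin] card_UN_inc[of v w] card_UN_inc[of w v]
    unfolding seen_edge[OF assms(1)] by linarith
qed

lemma joined_seen:
  assumes "{v, w} \<in> E" "{v, x} \<in> E" "{x, y} \<in> E" "x \<noteq> w"
  shows "{x, y} \<in> seen {v, w}"
proof -
  have "x \<in> nb v - {w}" "{x, y} \<in> inc x" using assms by (simp_all add: nb_iff inc_def)
  then show ?thesis unfolding seen_edge[OF assms(1)] by blast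
qed

lemma incident_seen:
  assumes "{v, w} \<in> E" "{v, x} \<in> E" "x \<noteq> w"
  shows "{v, x} \<in> seen {v, w}"
  using joined_seen[of v w x v] assms by (simp add: insert_commute)

section \<open>Extension of partial colourings\<close>

lemma color_step:
  assumes "colors_on E F c" "e \<in> E" "e \<notin> F" "card (seen e \<inter> F) \<le> 12"
  shows "\<exists>c'. colors_on E (insert e F) c' \<and> (\<forall>f\<in>F. c' f = c f)"
proof -
  have "card (c ` (seen e \<inter> F)) \<le> 12"
    using card_image_le[of "seen e \<inter> F" c] finite_seen assms(4) by simp
  then have "\<not> {..<13} \<subseteq> c ` (seen e \<inter> F)"
    using card_mono[of "c ` (seen e \<inter> F)" "{..<13::nat}"] finite_seen by auto
  then obtain k where k: "k < 13" "k \<notin> c ` (seen e \<inter> F)" by auto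
  have "c f \<noteq> k" if "f \<in> F" "sees E e f \<or> sees E f e" for f
    using that k(2) sees_sym[of E f e] unfolding seen_def by blast
  moreover have "\<not> sees E e e" using seen_irrefl by (simp add: seen_def)
  ultimately have "colors_on E (insert e F) (c(e := k))"
    using assms(1,3) k(1) unfolding colors_on_def by auto
  then show ?thesis using assms(3) by (intro exI[of _ "c(e := k)"]) auto
qed

text \<open>The bound already counts all of \<open>F \<union> M\<close>, so the edges of
  \<open>M\<close> can be coloured in any order.\<close>

lemma color_extend:
  assumes "colors_on E F c" "M \<subseteq> E" "M \<inter> F = {}"
    and "\<And>f. f \<in> M \<Longrightarrow> card (seen f \<inter> (F \<union> M)) \<le> 12"
  shows "\<exists>c'. colors_on E (F \<union> M) c' \<and> (\<forall>f\<in>F. c' f = c f)"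
proof -
  have "finite M" using assms(2) finite_E finite_subset by blast
  then show ?thesis
    using assms(2-)
  proof (induction M rule: finite_induct)
    case empty
    then show ?case using assms(1) by auto
  next
    case (insert e M)
    have "card (seen f \<inter> (F \<union> M)) \<le> 12" if "f \<in> insert e M" for f
      using insert.prems(3)[OF that] card_mono[of "seen f \<inter> (F \<union> insert e M)" "seen f \<inter> (F \<union> M)"]
        finite_seen by fastforce
    note small = this
    then obtain c' where c': "colors_on E (F \<union> M) c'" "\<forall>f\<in>F. c' f = c f"
      using insert.IH insert.prems by auto
    have "e \<in> E" "e \<notin> F \<union> M" using insert by auto
    with color_step[OF c'(1)] small obtain c'' where
      "colors_on E (insert e (F \<union> M)) c''" "\<forall>f\<in>F \<union> M. c'' f = c' f"
      by blast
    with c'(2) show ?case by (intro exI[of _ c'']) auto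
  qed
qed

text \<open>The pair \<open>e1\<close>, \<open>e2\<close> can be coloured so that \<open>e\<close>, which sees both, sees some colour twice: otherwise
  the lists of \<open>e1\<close> and \<open>e2\<close> and the colours already seen by \<open>e\<close> would be pairwise disjoint
  subsets of the 13 colours.\<close>

lemma color_pair_saving:
  assumes c: "colors_on E F c" and E: "e1 \<in> E" "e2 \<in> E" "e1 \<notin> F" "e2 \<notin> F" "e1 \<noteq> e2"
    and far: "e2 \<notin> seen e1" and e: "e1 \<in> seen e" "e2 \<in> seen e"
    and le: "card (seen e1 \<inter> F) \<le> 12" "card (seen e2 \<inter> F) \<le> 12"
    and less: "card (seen e1 \<inter> F) + card (seen e2 \<inter> F) < 13 + card (seen e \<inter> F)"
  shows "\<exists>c'. colors_on E (F \<union> {e1, e2}) c' \<and> \<not> inj_on c' (seen e \<inter> (F \<union> {e1, e2}))"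
proof -
  define L where "L g = {..<13} - c ` (seen g \<inter> F)" for g
  define C where "C = c ` (seen e \<inter> F)"
  have fin: "finite (seen g \<inter> F)" for g using finite_seen by blast
  have L: "card (L g) \<ge> 13 - card (seen g \<inter> F)" for g
    using diff_card_le_card_Diff[of "c ` (seen g \<inter> F)" "{..<13}"] card_image_le[OF fin, of c g] fin
    unfolding L_def by fastforce
  have ne: "L e1 \<noteq> {}" "L e2 \<noteq> {}" using L[of e1] L[of e2] le by auto
  have finL: "finite (L g)" for g by (simp add: L_def)
  \<comment> \<open>Each alternative makes \<open>e\<close> see some colour twice; in the last one
    this already holds on \<open>F\<close>.\<close>
  have "\<exists>x\<in>L e1. \<exists>y\<in>L e2. x = y \<or> x \<in> C \<or> y \<in> C \<or> \<not> inj_on c (seen e \<inter> F)"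
  proof (rule ccontr)
    assume *: "\<not> ?thesis"
    then have inj: "inj_on c (seen e \<inter> F)" and dis: "L e1 \<inter> L e2 = {}" "(L e1 \<union> L e2) \<inter> C = {}"
      using ne by blast+
    have "C \<subseteq> {..<13}" using c by (auto simp: C_def colors_on_def)
    then have "card (L e1 \<union> L e2 \<union> C) \<le> card {..<13::nat}"
      by (intro card_mono) (auto simp: L_def)
    moreover have "card (L e1 \<union> L e2 \<union> C) = card (L e1) + card (L e2) + card C"
      using dis finL fin by (subst card_Un_disjoint; auto simp: C_def card_Un_disjoint)
    moreover have "card C = card (seen e \<inter> F)" using inj by (simp add: C_def card_image)
    ultimately show False using L[of e1] L[of e2] le less by simp
  qed
  then obtain x y where xy: "x \<in> L e1" "y \<in> L e2"
    "x = y \<or> x \<in> C \<or> y \<in> C \<or> \<not> inj_on c (seen e \<inter> F)" by blast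
  define c' where "c' = c(e1 := x, e2 := y)"
  have c'F: "c' f = c f" if "f \<in> F" for f using that E by (auto simp: c'_def)
  have c'e: "c' e1 = x" "c' e2 = y" using E by (auto simp: c'_def)
  have avoid: "c f \<noteq> x" if "f \<in> F" "sees E e1 f \<or> sees E f e1" for f
    using that xy(1) sees_sym[of E f e1] unfolding L_def seen_def by blast
  have avoid': "c f \<noteq> y" if "f \<in> F" "sees E e2 f \<or> sees E f e2" for f
    using that xy(2) sees_sym[of E f e2] unfolding L_def seen_def by blast
  have no: "\<not> sees E e1 e1" "\<not> sees E e2 e2" "\<not> sees E e1 e2" "\<not> sees E e2 e1"
    using seen_irrefl far seen_sym[of e1 e2] by (auto simp: seen_def)
  have "x < 13" "y < 13" using xy by (auto simp: L_def)
  then have "colors_on E (F \<union> {e1, e2}) c'"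
    using c no avoid avoid' unfolding colors_on_def by (auto simp: c'F c'e)
  moreover have "\<not> inj_on c' (seen e \<inter> (F \<union> {e1, e2}))"
  proof
    assume inj: "inj_on c' (seen e \<inter> (F \<union> {e1, e2}))"
    have "inj_on c (seen e \<inter> F)"
      using inj_on_subset[OF inj, of "seen e \<inter> F"] c'F by (auto simp: inj_on_def)
    moreover have "x \<noteq> y" using inj_onD[OF inj, of e1 e2] E(5) e c'e by auto
    moreover have "x \<notin> C"
      using inj_onD[OF inj, of e1] E(3) e c'e c'F by (auto simp: C_def) metis
    moreover have "y \<notin> C"
      using inj_onD[OF inj, of e2] E(4) e c'e c'F by (auto simp: C_def) metis
    ultimately show False using xy(3) by blast
  qed
  ultimately show ?thesis by blast
qed

end

section \<open>Minimal counterexamples and small degrees\<close>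

locale critical_graph = fin_graph +
  assumes ore: "{v, w} \<in> E \<Longrightarrow> deg v + deg w \<le> 7"
    and deletion: "S \<subseteq> V \<Longrightarrow> S \<noteq> {} \<Longrightarrow> \<exists>c. colors_on E {e \<in> E. e \<inter> S = {}} c"
    and not_colorable: "\<not> colors_on E E c"
begin

text \<open>Every other uncoloured edge sees \<open>e\<close>, so with \<open>e\<close> kept for
  last it meets at most 12 coloured edges. For \<open>e\<close> itself only distinct colours on
  \<open>F\<close> count, which is where a repeated colour pays off.\<close>

lemma color_finish:
  assumes c: "colors_on E F c" and "F \<subseteq> E" "e \<in> E" "e \<notin> F"
    and M: "\<And>f. f \<in> E - F - {e} \<Longrightarrow> e \<in> seen f \<and> card (seen f) \<le> 13"
    and e: "card (c ` (seen e \<inter> F)) + card (seen e - F) \<le> 12"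
  shows False
proof -
  let ?M = "E - F - {e}"
  have "card (seen f \<inter> (F \<union> ?M)) \<le> 12" if "f \<in> ?M" for f
  proof -
    have "card (seen f \<inter> (F \<union> ?M)) \<le> card (seen f - {e})"
      by (rule card_mono) (use finite_seen assms(4) in auto)
    then show ?thesis using M[OF that] by auto
  qed
  then obtain c' where c': "colors_on E (F \<union> ?M) c'" "\<forall>f\<in>F. c' f = c f"
    using color_extend[OF c, of ?M] by blast
  have *: "F \<union> ?M = E - {e}" using assms by auto
  have "c' ` seen e \<subseteq> c ` (seen e \<inter> F) \<union> c' ` (seen e - F)"
    using c'(2) by force
  then have "card (c' ` seen e) \<le> card (c ` (seen e \<inter> F) \<union> c' ` (seen e - F))"
    by (rule card_mono[rotated]) (use finite_seen in auto)
  also have "\<dots> \<le> card (c ` (seen e \<inter> F)) + card (seen e - F)"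
    by (rule order_trans[OF card_Un_le]) (use finite_seen in \<open>auto intro: card_image_le\<close>)
  finally have "card (c' ` seen e) \<le> 12" using e by simp
  then have "\<not> {..<13} \<subseteq> c' ` seen e"
    using card_mono[of "c' ` seen e" "{..<13::nat}"] finite_seen by auto
  then obtain k where k: "k < 13" "k \<notin> c' ` seen e" by auto
  have avoid: "c' f \<noteq> k" if "sees E e f \<or> sees E f e" for f
    using that k(2) sees_sym[of E f e] unfolding seen_def by blast
  moreover have "\<not> sees E e e" using seen_irrefl by (simp add: seen_def)
  ultimately have "colors_on E E (c'(e := k))"
    using c'(1) k(1) unfolding * colors_on_def by auto
  then show False using not_colorable by blast
qed

text \<open>Delete \<open>v\<close>. The edges at \<open>v\<close> see each other, so those that see
  13 edges can be coloured while \<open>vw\<close> is uncoloured, and \<open>vw\<close> comes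
  last.\<close>

lemma star_reducible:
  assumes "w \<in> nb v" "card (seen {v, w}) \<le> 12"
    and "\<And>x. x \<in> nb v \<Longrightarrow> card (seen {v, x}) \<le> 13"
  shows False
proof -
  let ?F = "{e \<in> E. e \<inter> {v} = {}}"
  have vw: "{v, w} \<in> E" "v \<in> V" using assms(1) nb_in_V by (auto simp: nb_iff)
  then obtain c where c: "colors_on E ?F c" using deletion[of "{v}"] by auto
  have "card (c ` (seen {v, w} \<inter> ?F)) \<le> card (seen {v, w} \<inter> ?F)"
    by (rule card_image_le) (use finite_seen in auto)
  moreover have "card (seen {v, w} \<inter> ?F) + card (seen {v, w} - ?F) = card (seen {v, w})"
    using card_Int_Diff[OF finite_seen] by metis
  ultimately have "card (c ` (seen {v, w} \<inter> ?F)) + card (seen {v, w} - ?F) \<le> 12"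
    using assms(2) by linarith
  moreover have "{v, w} \<in> seen f \<and> card (seen f) \<le> 13" if "f \<in> E - ?F - {{v, w}}" for f
  proof -
    from that obtain x where x: "f = {v, x}" "x \<noteq> w" "{v, x} \<in> E"
      using edge_ex[of f v] by auto
    then show ?thesis using assms(3)[of x] incident_seen[of v x w] vw by (auto simp: nb_iff)
  qed
  ultimately show False
    using color_finish[OF c, of "{v, w}"] vw by auto
qed

lemma wt_le: "{v, w} \<in> E \<Longrightarrow> wt v w \<le> (deg v - 1) * (7 - deg v)"
proof -
  assume vw: "{v, w} \<in> E"
  have "deg x \<le> 7 - deg v" if "x \<in> nb v - {w}" for x
    using ore[of v x] that by (auto simp: nb_iff)
  then have "wt v w \<le> of_nat (card (nb v - {w})) * (7 - deg v)"
    unfolding wt_def by (rule sum_bounded_above)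
  then show ?thesis
    using vw by (simp add: nb_iff card_nb)
qed

lemma deg_ne_0:
  assumes "v \<in> V"
  shows "deg v \<noteq> 0"
proof
  assume "deg v = 0"
  then have "inc v = {}" using card_inc[of v] finite_inc[of v] by auto
  then have "{e \<in> E. e \<inter> {v} = {}} = E" by (auto simp: inc_def)
  then show False using deletion[of "{v}"] assms not_colorable by auto
qed

text \<open>The edge \<open>vw\<close> at a pendant vertex \<open>v\<close> sees edges only through
  \<open>w\<close>, and there are at most 9 of them by \<open>wt_le\<close>.\<close>

lemma deg_ge_2:
  assumes "v \<in> V"
  shows "2 \<le> deg v"
proof (rule ccontr)
  assume "\<not> ?thesis"
  then have "deg v = 1" using deg_ne_0[OF assms] by linarith
  then obtain w where w: "nb v = {w}"
    using card_nb[of v] by (auto simp: card_1_singleton_iff)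
  then have vw: "{v, w} \<in> E" "{w, v} \<in> E" by (auto simp: nb_def insert_commute)
  have "deg w \<le> 6" using ore[OF vw(1)] \<open>deg v = 1\<close> by simp
  then have "deg w \<in> {0,1,2,3,4,5,6}" by auto
  then have "(deg w - 1) * (7 - deg w) \<le> 12" by auto
  moreover have "wt v w = 0" by (simp add: wt_def w)
  ultimately have "card (seen {v, w}) \<le> 12"
    using card_seen_le[OF vw(1)] wt_le[OF vw(2)] by simp
  then show False using star_reducible[of w v] w by simp
qed

lemma deg_le_5:
  assumes "v \<in> V"
  shows "deg v \<le> 5"
proof -
  have "card (nb v) \<noteq> 0" using deg_ge_2[OF assms] by (simp add: card_nb)
  then obtain w where "w \<in> nb v" by fastforce
  then show ?thesis using ore[of v w] deg_ge_2[of w] nb_in_V[of w v] by (simp add: nb_iff)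
qed

lemma two_nb:
  assumes "deg x = 2" "y \<in> nb x"
  obtains z where "nb x = {y, z}" "y \<noteq> z"
proof -
  obtain a b where "nb x = {a, b}" "a \<noteq> b"
    using assms(1) card_nb[of x] by (auto simp: card_2_iff)
  with assms(2) that show ?thesis by (metis insert_iff insert_commute singletonD)
qed

text \<open>If \<open>z\<close> had degree at most 3 and \<open>y\<close> is the other neighbour of
  \<open>x\<close>, then \<open>xy\<close> would see at most 3 + 9 = 12 edges and \<open>xz\<close>
  at most 5 + 8 = 13, so the star at \<open>x\<close> would be reducible.\<close>

lemma two_nb_ge_4:
  assumes "deg x = 2" "z \<in> nb x"
  shows "4 \<le> deg z"
proof (rule ccontr)
  assume z: "\<not> ?thesis"
  obtain y where y: "nb x = {z, y}" "z \<noteq> y" using two_nb[OF assms] .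
  then have e: "{x, y} \<in> E" "{y, x} \<in> E" "{x, z} \<in> E" "{z, x} \<in> E"
    by (auto simp: nb_def insert_commute)
  then have V: "y \<in> V" "z \<in> V" using edgeD by blast+
  have wt: "wt x y = deg z" "wt x z = deg y" using y by (auto simp: wt_def insert_Diff_if)
  have "deg y \<in> {2,3,4,5}" "deg z \<in> {2,3}"
    using deg_ge_2[OF V(1)] deg_le_5[OF V(1)] deg_ge_2[OF V(2)] z by auto
  then have "(deg y - 1) * (7 - deg y) \<le> 9" "(deg z - 1) * (7 - deg z) \<le> 8" "deg z \<le> 3" "deg y \<le> 5"
    by auto
  then have "card (seen {x, y}) \<le> 12" "card (seen {x, z}) \<le> 13"
    using card_seen_le[OF e(1)] card_seen_le[OF e(3)] wt_le[OF e(2)] wt_le[OF e(4)] wt by linarith+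
  then show False by (intro star_reducible[of y x]) (use y in auto)
qed

section \<open>Repeated colours and the exclusion of 5-vertices\<close>

lemma color_finish_saving:
  assumes "colors_on E F c" "F \<subseteq> E" "e \<in> E" "e \<notin> F"
    and "\<And>f. f \<in> E - F - {e} \<Longrightarrow> e \<in> seen f \<and> card (seen f) \<le> 13"
    and ninj: "\<not> inj_on c (seen e \<inter> F)" and e: "card (seen e) \<le> 13"
  shows False
proof -
  have "card (c ` (seen e \<inter> F)) < card (seen e \<inter> F)"
    using ninj card_image_le[of "seen e \<inter> F" c] eq_card_imp_inj_on[of "seen e \<inter> F" c] finite_seen[of e]
    by fastforce
  moreover have "card (seen e \<inter> F) + card (seen e - F) = card (seen e)"
    using card_Int_Diff[OF finite_seen] by metis
  ultimately have "card (c ` (seen e \<inter> F)) + card (seen e - F) \<le> 12" using e by linarith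
  with assms(1-5) show False using color_finish by blast
qed

lemma card_seen_Int_le:
  assumes "card (seen e) \<le> m" "T \<subseteq> seen e" "T \<inter> F = {}"
  shows "card (seen e \<inter> F) \<le> m - card T"
proof -
  have "card (seen e \<inter> F) \<le> card (seen e - T)"
    by (rule card_mono) (use finite_seen assms(3) in auto)
  also have "\<dots> = card (seen e) - card T"
    by (rule card_Diff_subset) (use assms(2) finite_seen finite_subset in auto)
  finally show ?thesis using assms(1) by simp
qed

text \<open>All neighbours of a 5-vertex \<open>y\<close> are 2-vertices. Delete \<open>y\<close>
  and two of them, \<open>x1\<close> and \<open>x2\<close>; their outer edges can be coloured so
  that \<open>yx0\<close>, for a third neighbour \<open>x0\<close>, sees a repeated colour. Then
  \<open>yx0\<close> is coloured last.\<close>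

lemma deg_ne_5: "deg y \<noteq> 5"
proof
  assume y: "deg y = 5"
  have nb2: "deg x = 2" if "x \<in> nb y" for x
    using ore[of y x] deg_ge_2[of x] that y nb_in_V[OF that] by (simp add: nb_iff)
  have wt8: "wt y x = 8" if "x \<in> nb y" for x
    using that nb2 finite_nb card_nb[of y] y by (simp add: wt_def)
  have wtz: "wt x y = deg z" if "nb x = {y, z}" "y \<noteq> z" for x z
    using that by (simp add: wt_def insert_Diff_if)
  have le13: "card (seen {y, x}) \<le> 13" if x: "x \<in> nb y" for x
  proof -
    obtain z where z: "nb x = {y, z}" "y \<noteq> z" using two_nb[of x y] nb2 x nb_sym[of x y] by blast
    then have "deg z \<le> 5" using deg_le_5 nb_in_V[of z x] by blast
    then show ?thesis using card_seen_le[of y x] wt8[OF x] wtz[OF z] x by (simp add: nb_iff)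
  qed
  then have eq13: "card (seen {y, x}) = 13" if x: "x \<in> nb y" for x
    using star_reducible[OF x] le13[OF x] by fastforce
  \<comment> \<open>\<open>yx\<close> sees exactly 13 = 8 + 5 edges, so the bound is attained: a
    smaller degree of \<open>z\<close> or a 4-cycle through \<open>z\<close> would make it
    strict.\<close>
  have outer: "deg z = 5 \<and> (\<forall>x'\<in>nb y - {x}. {x', z} \<notin> E)"
    if x: "x \<in> nb y" and z: "nb x = {y, z}" "y \<noteq> z" for x z
  proof
    have e: "{y, x} \<in> E" using x by (simp add: nb_iff)
    have w: "wt y x + wt x y = 8 + deg z" using wt8[OF x] wtz[OF z] by simp
    have "deg z \<le> 5" using deg_le_5 nb_in_V[of z x] z by blast
    then show z5: "deg z = 5" using card_seen_le[OF e] w eq13[OF x] by simp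
    show "\<forall>x'\<in>nb y - {x}. {x', z} \<notin> E"
      using card_seen_less[OF e, of _ z] w eq13[OF x] z z5 by auto
  qed
  obtain T where "T \<subseteq> nb y" "card T = 3"
    using obtain_subset_with_card_n[of 3 "nb y"] card_nb[of y] y by auto
  then obtain x0 x1 x2 where x: "x0 \<in> nb y" "x1 \<in> nb y" "x2 \<in> nb y"
    and xne: "x0 \<noteq> x1" "x0 \<noteq> x2" "x1 \<noteq> x2"
    by (auto simp: card_3_iff)
  obtain z1 where z1: "nb x1 = {y, z1}" "y \<noteq> z1" using two_nb[of x1 y] nb2 x nb_sym[of x1 y] by blast
  obtain z2 where z2: "nb x2 = {y, z2}" "y \<noteq> z2" using two_nb[of x2 y] nb2 x nb_sym[of x2 y] by blast
  note o1 = outer[OF x(2) z1] and o2 = outer[OF x(3) z2]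
  have ed: "{y, x0} \<in> E" "{y, x1} \<in> E" "{y, x2} \<in> E" "{x1, y} \<in> E" "{x2, y} \<in> E"
    "{x1, z1} \<in> E" "{x2, z2} \<in> E" "{z1, x1} \<in> E" "{z2, x2} \<in> E"
    using x z1 z2 by (auto simp: nb_def insert_commute)
  have zne: "z1 \<noteq> z2" using o1 ed x xne by auto
  have ne: "y \<noteq> x0" "y \<noteq> x1" "y \<noteq> x2" "x1 \<noteq> z1" "x2 \<noteq> z2" using ed edgeD by blast+
  have ne': "x2 \<noteq> z1" "x1 \<noteq> z2" using nb2 x o1 o2 by force+
  let ?S = "{y, x1, x2}" and ?e1 = "{x1, z1}" and ?e2 = "{x2, z2}" and ?e = "{y, x0}"
  let ?F = "{e \<in> E. e \<inter> ?S = {}}"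
  have "?S \<subseteq> V" using ed edgeD by blast
  then obtain c where c: "colors_on E ?F c" using deletion[of ?S] by blast
  have notF: "E - ?F = inc y \<union> {?e1, ?e2}"
  proof -
    have "E - ?F = inc y \<union> inc x1 \<union> inc x2" by (auto simp: inc_def)
    also have "inc x1 = {{x1, y}, ?e1}" by (simp add: inc_eq_image z1)
    also have "inc x2 = {{x2, y}, ?e2}" by (simp add: inc_eq_image z2)
    finally show ?thesis using ed by (auto simp: inc_def insert_commute)
  qed
  \<comment> \<open>The edge \<open>xz\<close> sees at most 5 + 8 = 13 edges, among them the five
    uncoloured edges at \<open>y\<close>.\<close>
  have list8: "card (seen {x, z} \<inter> ?F) \<le> 8" if "x \<in> nb y" "nb x = {y, z}" "y \<noteq> z" for x z
  proof -
    have xz: "{x, z} \<in> E" "{z, x} \<in> E" using that(2) by (auto simp: nb_def insert_commute)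
    have "deg z = 5" using outer that by blast
    moreover have "wt x z = 5" using that y by (simp add: wt_def insert_Diff_if)
    ultimately have "card (seen {x, z}) \<le> 13"
      using card_seen_le[OF xz(1)] wt_le[OF xz(2)] by simp
    moreover have "inc y \<subseteq> seen {x, z}" using that by (auto simp: seen_edge[OF xz(1)])
    moreover have "inc y \<inter> ?F = {}" by (auto simp: inc_def)
    ultimately have "card (seen {x, z} \<inter> ?F) \<le> 13 - card (inc y)" by (rule card_seen_Int_le)
    then show ?thesis using y by (simp add: card_inc)
  qed
  \<comment> \<open>The only links to fear are \<open>z1x2\<close>, a 4-cycle excluded by
    \<open>outer\<close>, and \<open>z1z2\<close>, whose ends would have degree sum 10.\<close>
  have far: "?e2 \<notin> seen ?e1"
  proof
    assume "?e2 \<in> seen ?e1"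
    then have "y \<in> ?e2 \<or> x2 \<in> nb z1 \<or> z2 \<in> nb z1"
      using z1 unfolding seen_edge[OF ed(6)] by (auto simp: inc_def)
    moreover have "x2 \<notin> nb z1" using o1 x xne by (auto simp: nb_iff insert_commute)
    moreover have "z2 \<notin> nb z1" using ore[of z1 z2] o1 o2 by (auto simp: nb_iff)
    ultimately show False using z2 ne by auto
  qed
  have seen_e: "?e1 \<in> seen ?e" "?e2 \<in> seen ?e" using joined_seen ed xne by metis+
  \<comment> \<open>At most six of the seen edges are uncoloured: four at \<open>y\<close> and the
    two outer edges. The saving then needs only 8 + 8 < 13 + 7.\<close>
  have "13 - 6 \<le> card (seen ?e \<inter> ?F)"
  proof -
    let ?T = "(inc y - {?e}) \<union> {?e1, ?e2}"
    have "card ?T \<le> card (inc y - {?e}) + card {?e1, ?e2}" by (rule card_Un_le)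
    also have "card {?e1, ?e2} \<le> 2" by (simp add: card_insert_if)
    also have "card (inc y - {?e}) = 4"
      using ed y card_inc[of y] by (subst card_Diff_singleton) (auto simp: inc_def)
    finally have "card ?T \<le> 6" by simp
    moreover have "card (seen ?e) - card ?T \<le> card (seen ?e - ?T)"
      by (rule diff_card_le_card_Diff) (simp add: finite_inc)
    moreover have "seen ?e - ?T \<subseteq> seen ?e \<inter> ?F"
      using notF seen_sub seen_irrefl[of ?e] by blast
    then have "card (seen ?e - ?T) \<le> card (seen ?e \<inter> ?F)"
      by (rule card_mono[rotated]) (simp add: finite_seen)
    ultimately show ?thesis using eq13[OF x(1)] by linarith
  qed
  then obtain c' where c': "colors_on E (?F \<union> {?e1, ?e2}) c'"
    "\<not> inj_on c' (seen ?e \<inter> (?F \<union> {?e1, ?e2}))"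
    using color_pair_saving[OF c ed(6,7) _ _ _ far seen_e] list8[OF x(2) z1] list8[OF x(3) z2]
      xne ne' zne by (auto simp: doubleton_eq_iff)
  show False
  proof (rule color_finish_saving[OF c'(1) _ ed(1) _ _ c'(2)])
    show "?F \<union> {?e1, ?e2} \<subseteq> E" using ed by blast
    show "?e \<notin> ?F \<union> {?e1, ?e2}" using ne z1 z2 by (auto simp: doubleton_eq_iff)
    show "card (seen ?e) \<le> 13" using eq13 x by simp
    fix f assume "f \<in> E - (?F \<union> {?e1, ?e2}) - {?e}"
    then have "f \<in> inc y" "f \<noteq> ?e" using notF by blast+
    then obtain w where "f = {y, w}" "w \<in> nb y" "w \<noteq> x0" unfolding inc_eq_image by blast
    then show "?e \<in> seen f \<and> card (seen f) \<le> 13"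
      using incident_seen[of y w x0] ed(1) le13 by (simp add: nb_iff)
  qed
qed

section \<open>Neighbourhoods of 2-vertices and 4-vertices\<close>

lemma deg_cases:
  assumes "v \<in> V"
  shows "deg v = 2 \<or> deg v = 3 \<or> deg v = 4"
  using deg_ge_2[OF assms] deg_le_5[OF assms] deg_ne_5[of v] by linarith

lemma two_nb_4: "deg x = 2 \<Longrightarrow> y \<in> nb x \<Longrightarrow> deg y = 4"
  using two_nb_ge_4[of x y] deg_cases[of y] nb_in_V[of y x] by fastforce

text \<open>Both edges at \<open>x\<close> see at most 4 + 9 = 13 edges. If \<open>wt y x\<close>
  were below 9, then \<open>xy\<close> would see at most 12 and the star at \<open>x\<close> would
  be reducible.\<close>

lemma two_wt:
  assumes "deg x = 2" "y \<in> nb x"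
  shows "wt x y = 4" "wt y x = 9" "card (seen {x, y}) \<le> 13"
proof -
  have *: "wt a b = 4 \<and> wt b a \<le> 9 \<and> card (seen {a, b}) \<le> 4 + wt b a"
    if a: "deg a = 2" "b \<in> nb a" for a b
  proof -
    obtain z where z: "nb a = {b, z}" "b \<noteq> z" using two_nb[OF a] .
    then have "wt a b = 4" using two_nb_4[OF a(1), of z] by (simp add: wt_def insert_Diff_if)
    moreover have "wt b a \<le> 9"
      using wt_le[of b a] two_nb_4[OF a] a nb_sym by (simp add: nb_iff)
    ultimately show ?thesis using card_seen_le[of a b] a by (simp add: nb_iff)
  qed
  show "wt x y = 4" using *[OF assms] by blast
  show "card (seen {x, y}) \<le> 13" using *[OF assms] by linarith
  have "card (seen {x, w}) \<le> 13" if "w \<in> nb x" for w using *[OF assms(1) that] by linarith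
  then have "\<not> card (seen {x, y}) \<le> 12" using star_reducible[OF assms(2)] by blast
  then show "wt y x = 9" using *[OF assms] by linarith
qed

lemma four_nb:
  assumes "deg p = 4" "w \<in> nb p"
  shows "deg w = 2 \<or> deg w = 3"
  using ore[of p w] deg_cases[of w] nb_in_V[of w p] assms by (auto simp: nb_iff)

text \<open>The three other neighbours of \<open>p\<close> have degree at most 3, and by
  \<open>two_wt\<close> their degrees sum to 9.\<close>

lemma poor_nb:
  assumes "deg x = 2" "p \<in> nb x" "w \<in> nb p - {x}"
  shows "deg w = 3"
proof (rule ccontr)
  assume w: "deg w \<noteq> 3"
  have p: "deg p = 4" using two_nb_4 assms by blast
  have le: "deg y \<le> 3" if "y \<in> nb p - {x}" for y using four_nb[OF p, of y] that by auto
  have "wt p x < (\<Sum>y\<in>nb p - {x}. 3)"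
    unfolding wt_def
    by (rule sum_strict_mono_ex1) (use le w assms(3) finite_nb in \<open>auto intro!: bexI[of _ w] simp: order_less_le\<close>)
  also have "\<dots> = 9" using assms(2) p card_nb[of p] nb_sym[of p x] by simp
  finally show False using two_wt(2)[OF assms(1,2)] by simp
qed

lemma wt_add: "u \<in> nb v \<Longrightarrow> wt v u + deg u = (\<Sum>x\<in>nb v. deg x)"
  using sum.remove[OF finite_nb, of u v deg] by (simp add: wt_def)

section \<open>3-vertices and needy vertices\<close>

definition nb4 :: "'a \<Rightarrow> 'a set" where
  "nb4 v = {w \<in> nb v. deg w = 4}"

text \<open>In the discharging a 3-vertex lacks charge 3. These are the ones with neither a
  4-neighbour nor a neighbour that can supply all of it, so they collect 1 from each
  neighbour.\<close>

definition needy :: "'a \<Rightarrow> bool" where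
  "needy u \<longleftrightarrow> deg u = 3 \<and> nb4 u = {} \<and> (\<forall>v\<in>nb u. card (nb4 v) \<le> 1)"

lemma finite_nb4: "finite (nb4 v)"
  using finite_nb by (simp add: nb4_def)

lemma three_nb: "deg v = 3 \<Longrightarrow> w \<in> nb v \<Longrightarrow> deg w = 3 \<or> deg w = 4"
  using deg_cases[of w] nb_in_V[of w v] two_nb_4[of w v] nb_sym[of v w] by auto

lemma three_wt:
  assumes "deg v = 3" "u \<in> nb v"
  shows "wt v u + deg u = 9 + card (nb4 v)"
proof -
  have "(\<Sum>x\<in>nb v. deg x) = (\<Sum>x\<in>nb v. 3 + of_bool (deg x = 4))"
    by (rule sum.cong) (use three_nb[OF assms(1)] in auto)
  also have "\<dots> = 9 + card (nb4 v)"
    using finite_nb card_nb[of v] assms(1) by (simp add: sum.distrib nb4_def Int_def)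
  finally show ?thesis using wt_add[OF assms(2)] by simp
qed

text \<open>An edge \<open>ux\<close> sees at most 6 + 6 edges plus one for each 4-neighbour of
  \<open>x\<close>. If some \<open>x\<close> had no 4-neighbour, the star at \<open>u\<close> would
  be reducible.\<close>

lemma needy_nb:
  assumes "needy u" "v \<in> nb u"
  shows "deg v = 3" "card (nb4 v) = 1" "card (seen {u, v}) = 13"
proof -
  have *: "deg x = 3 \<and> card (seen {u, x}) \<le> 12 + card (nb4 x) \<and> card (nb4 x) \<le> 1"
    if x: "x \<in> nb u" for x
  proof -
    have u: "deg u = 3" "nb4 u = {}" using assms(1) by (auto simp: needy_def)
    then have x3: "deg x = 3" using three_nb[OF _ x] x by (auto simp: nb4_def)
    then have "wt u x = 6" "wt x u = 6 + card (nb4 x)"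
      using three_wt[OF u(1) x] three_wt[of x u] x nb_sym[of u x] u by auto
    then show ?thesis
      using card_seen_le[of u x] x x3 assms(1) by (simp add: nb_iff needy_def)
  qed
  have "card (seen {u, x}) \<le> 13" if "x \<in> nb u" for x using *[OF that] by linarith
  then have "\<not> card (seen {u, v}) \<le> 12" using star_reducible[OF assms(2)] by blast
  with *[OF assms(2)] show "deg v = 3" "card (nb4 v) = 1" "card (seen {u, v}) = 13" by linarith+
qed

text \<open>With \<open>u\<close>, \<open>v\<close>, \<open>x\<close> deleted, \<open>xz\<close> and \<open>vp\<close> are coloured first; then \<open>xp\<close> and \<open>ua\<close> can be
  coloured so that \<open>uv\<close>, the last edge to be coloured, sees a repeated colour.\<close>

lemma needy_pair_reducible:
  assumes u: "needy u" and v: "v \<in> nb u" and p: "p \<in> nb v" "deg p = 4"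
    and x: "x \<in> nb p" "deg x = 2" and u': "u' \<in> nb v" "u' \<noteq> u" "deg u' = 3" "nb4 u' = {}"
  shows False
proof -
  note nv = needy_nb[OF u v]
  have du: "deg u = 3" "nb4 u = {}" using u by (auto simp: needy_def)
  have uv: "u \<in> nb v" using v nb_sym by blast
  have "p \<noteq> u" "p \<noteq> u'" using p(2) du(1) u'(3) by auto
  then have "{p, u, u'} \<subseteq> nb v" "card {p, u, u'} = 3" using p(1) u'(1,2) uv by auto
  then have nbv: "nb v = {p, u, u'}"
    using card_nb[of v] nv(1) finite_nb by (metis card_subset_eq)
  have "card (nb u - {v}) = 2" using card_nb[of u] du v by simp
  then obtain a b where ab: "nb u - {v} = {a, b}" "a \<noteq> b" by (auto simp: card_2_iff)
  then have abu: "a \<in> nb u" "b \<in> nb u" "a \<noteq> v" "b \<noteq> v" and nbu: "nb u = {v, a, b}" using v by auto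
  have px: "p \<in> nb x" using x nb_sym by blast
  obtain z where z: "nb x = {p, z}" "p \<noteq> z" using two_nb[OF x(2) px] .
  have dz: "deg z = 4" using two_nb_4[OF x(2), of z] z by simp
  note na = needy_nb[OF u abu(1)] and nb = needy_nb[OF u abu(2)]
  have "u' \<noteq> a" "u' \<noteq> b" using na nb u' by auto
  moreover have "u \<noteq> v" "u \<noteq> a" "u \<noteq> b" "v \<noteq> u'" using nb_irrefl v abu u' by auto
  ultimately have dist: "distinct [x, p, z, u, v, u', a, b]"
    using z(2) x(2) p(2) dz du nv(1) na(1) nb(1) u'(2,3) ab(2) abu(3,4) by auto
  then have dist': "distinct [b, a, u', v, u, z, p, x]" by auto
  have ed: "{u, v} \<in> E" "{v, u} \<in> E" "{u, a} \<in> E" "{u, b} \<in> E" "{v, p} \<in> E" "{p, v} \<in> E"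
    "{v, u'} \<in> E" "{u', v} \<in> E" "{x, p} \<in> E" "{p, x} \<in> E" "{x, z} \<in> E"
    using v uv abu p u'(1) x px z by (auto simp: nb_def insert_commute)
  have sxp: "card (seen {x, p}) \<le> 13" and sxz: "card (seen {x, z}) \<le> 13"
    using two_wt(3)[OF x(2)] z by auto
  have wvp: "wt v p = 6" and wvu': "wt v u' = 7" and wu'v: "wt u' v = 6" and wvu: "wt v u = 7" and wuv: "wt u v = 6"
    using three_wt[OF nv(1) p(1)] three_wt[OF nv(1) u'(1)] three_wt[OF u'(3), of v]
      three_wt[OF nv(1) uv] three_wt[OF du(1) v] nv p u' du nb_sym[of u' v] by auto
  \<comment> \<open>The degrees around \<open>p\<close> sum to 9 + 2 = 11, and \<open>v\<close>
    accounts for 3 of this.\<close>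
  have "wt p v = 8"
    using wt_add[of x p] wt_add[of v p] two_wt(2)[OF x(2) px] x nv(1) p(1) nb_sym[of p v] by simp
  then have svp: "card (seen {v, p}) \<le> 14" using card_seen_le[OF ed(5)] wvp by simp
  have svu': "card (seen {v, u'}) \<le> 13" using card_seen_le[OF ed(7)] wvu' wu'v by simp
  \<comment> \<open>Such an edge would close a 4-cycle, leaving \<open>uv\<close> with fewer than 6
    + 7 = 13 seen edges.\<close>
  have pa: "{p, a} \<notin> E"
    using card_seen_less[OF ed(1), of a p] abu p nbu nbv nv(3) wvu wuv dist by (auto simp: insert_commute)
  let ?S = "{x, u, v}" and ?e1 = "{x, p}" and ?e2 = "{u, a}" and ?e = "{u, v}"
  define F where "F = {e \<in> E. e \<inter> ?S = {}}"
  define M where "M = {{x, z}, {v, p}}"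
  \<comment> \<open>The edges still uncoloured once \<open>M\<close> has been coloured.\<close>
  define R where "R = {?e1, ?e2, ?e, {u, b}, {v, u'}}"
  have "?S \<subseteq> V" using ed edgeD by simp
  then obtain c where c: "colors_on E F c" using deletion[of ?S] unfolding F_def by blast
  have FE: "F \<subseteq> E" by (auto simp: F_def)
  have notF: "E - F = R \<union> M"
  proof -
    have "E - F = inc x \<union> inc u \<union> inc v" by (auto simp: inc_def F_def)
    also have "\<dots> = R \<union> M" unfolding inc_eq_image z(1) nbu nbv R_def M_def by (auto simp: insert_commute)
    finally show ?thesis .
  qed
  have RM: "R \<inter> M = {}" using dist by (auto simp: doubleton_eq_iff R_def M_def)
  then have disj: "R \<inter> (F \<union> M) = {}" using notF by blast
  have FM: "E - (F \<union> M) = R" using notF RM by blast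
  have eR: "?e1 \<in> R" "?e2 \<in> R" "?e \<in> R" "{u, b} \<in> R" "{v, u'} \<in> R" by (simp_all add: R_def)
  have sees: "?e1 \<in> seen {x, z}" "?e \<in> seen {v, p}" "{v, u'} \<in> seen {v, p}"
    "?e \<in> seen ?e1" "{v, u'} \<in> seen ?e1" "?e \<in> seen ?e2" "{u, b} \<in> seen ?e2" "{v, u'} \<in> seen ?e2"
    "?e1 \<in> seen ?e" "?e2 \<in> seen ?e" "?e \<in> seen {u, b}" "?e \<in> seen {v, u'}"
    using incident_seen[of x z p] incident_seen[of v p u] incident_seen[of v p u']
      joined_seen[of p x v u] joined_seen[of p x v u']
      incident_seen[of u a v] incident_seen[of u a b] joined_seen[of u a v u']
      joined_seen[of v u p x] incident_seen[of u v a] incident_seen[of u b v] incident_seen[of v u' u]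
      ed dist dist' by (simp_all add: insert_commute)
  have card_T: "card {?e, {v, u'}} = 2" "card {?e, {u, b}, {v, u'}} = 3"
    using dist by (simp_all add: doubleton_eq_iff)
  \<comment> \<open>The edge \<open>xz\<close> sees the uncoloured \<open>xp\<close>, and
    \<open>vp\<close>, with up to 14 seen edges, sees the uncoloured \<open>uv\<close> and
    \<open>vu'\<close>.\<close>
  have "card (seen {x, z} \<inter> (F \<union> M)) \<le> 13 - card {?e1}"
    by (rule card_seen_Int_le[OF sxz]) (use sees eR disj in auto)
  moreover have "card (seen {v, p} \<inter> (F \<union> M)) \<le> 14 - card {?e, {v, u'}}"
    by (rule card_seen_Int_le[OF svp]) (use sees eR disj in auto)
  ultimately have "\<And>f. f \<in> M \<Longrightarrow> card (seen f \<inter> (F \<union> M)) \<le> 12"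
    unfolding card_T M_def by auto
  moreover have "M \<subseteq> E" "M \<inter> F = {}" using notF by blast+
  ultimately obtain c1 where c1: "colors_on E (F \<union> M) c1"
    using color_extend[OF c, of M] by blast
  have "card (seen ?e1 \<inter> (F \<union> M)) \<le> 13 - card {?e, {v, u'}}"
    by (rule card_seen_Int_le[OF sxp]) (use sees eR disj in auto)
  then have l1: "card (seen ?e1 \<inter> (F \<union> M)) \<le> 11" unfolding card_T by simp
  have "card (seen ?e2 \<inter> (F \<union> M)) \<le> 13 - card {?e, {u, b}, {v, u'}}"
    by (rule card_seen_Int_le[OF eq_refl[OF na(3)]]) (use sees eR disj in auto)
  then have l2: "card (seen ?e2 \<inter> (F \<union> M)) \<le> 10" unfolding card_T by simp
  \<comment> \<open>At most four of the 13 edges seen by \<open>uv\<close> are uncoloured. The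
    saving condition is then just met: 11 + 10 < 13 + 9.\<close>
  have l3: "9 \<le> card (seen ?e \<inter> (F \<union> M))"
  proof -
    have "card (R - {?e}) \<le> 4"
      by (simp add: R_def card_insert_if card_Diff_singleton_if)
    moreover have "card (seen ?e) - card (R - {?e}) \<le> card (seen ?e - (R - {?e}))"
      by (rule diff_card_le_card_Diff) (simp add: R_def)
    moreover have "seen ?e - (R - {?e}) \<subseteq> seen ?e \<inter> (F \<union> M)"
      using FM seen_sub[of ?e] seen_irrefl[of ?e] by blast
    then have "card (seen ?e - (R - {?e})) \<le> card (seen ?e \<inter> (F \<union> M))"
      by (rule card_mono[rotated]) (simp add: finite_seen)
    ultimately show ?thesis using nv(3) by linarith
  qed
  have far: "?e2 \<notin> seen ?e1"
  proof
    assume "?e2 \<in> seen ?e1"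
    then have "z \<in> ?e2 \<or> u \<in> nb p \<or> a \<in> nb p"
      unfolding seen_edge[OF ed(9)] z(1) by (auto simp: inc_def)
    moreover have "u \<notin> nb p" using du p(2) nb_sym[of u p] by (auto simp: nb4_def)
    ultimately show False using pa dist by (auto simp: nb_iff)
  qed
  have notFM: "?e1 \<notin> F \<union> M" "?e2 \<notin> F \<union> M" "?e \<notin> F \<union> M" using eR disj by blast+
  have ne: "?e1 \<noteq> ?e2" "?e \<noteq> ?e1" "?e \<noteq> ?e2" using dist dist' by (simp_all add: doubleton_eq_iff)
  obtain c2 where c2: "colors_on E (F \<union> M \<union> {?e1, ?e2}) c2"
    "\<not> inj_on c2 (seen ?e \<inter> (F \<union> M \<union> {?e1, ?e2}))"
    using color_pair_saving[OF c1 ed(9,3) notFM(1,2) ne(1) far sees(9,10)] l1 l2 l3 by auto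
  show False
  proof (rule color_finish_saving[OF c2(1) _ ed(1) _ _ c2(2)])
    show "F \<union> M \<union> {?e1, ?e2} \<subseteq> E" using FE \<open>M \<subseteq> E\<close> ed(9,3) by simp
    show "?e \<notin> F \<union> M \<union> {?e1, ?e2}" using notFM(3) ne by simp
    show "card (seen ?e) \<le> 13" using nv by simp
    fix f assume "f \<in> E - (F \<union> M \<union> {?e1, ?e2}) - {?e}"
    then have "f \<in> R - {?e1, ?e2, ?e}" using FM by blast
    then have "f = {u, b} \<or> f = {v, u'}" unfolding R_def by blast
    then show "?e \<in> seen f \<and> card (seen f) \<le> 13" using sees(11,12) nb(3) svu' by auto
  qed
qed

text \<open>Discharging with initial charge \<open>33 deg v - 102\<close>, a positive multiple of \<open>deg v - 34/11\<close>.\<close>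

definition flow :: "'a \<Rightarrow> 'a \<Rightarrow> int" where
  "flow v w =
    (if deg v = 4 then if deg w = 2 then 18 else if \<exists>x\<in>nb v. deg x = 2 then 4 else 5
     else if deg v = 3 \<and> deg w = 3 \<and> nb4 w = {}
     then if 2 \<le> card (nb4 v) then 3 else if needy w then 1 else 0
     else 0)"

lemma flow_nonneg: "0 \<le> flow v w"
  by (simp add: flow_def)

section \<open>Final charges and the edge bound\<close>

text \<open>The initial charge is -36, and each of the two 4-neighbours sends 18.\<close>

lemma final_charge_two:
  assumes "deg v = 2"
  shows "33 * int (deg v) - 102 + (\<Sum>w\<in>nb v. flow w v) - (\<Sum>w\<in>nb v. flow v w) \<ge> 0"
proof -
  have "flow v w = 0" for w using assms by (simp add: flow_def)
  moreover have "flow w v = 18" if "w \<in> nb v" for w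
    using two_nb_4[OF assms that] assms by (simp add: flow_def)
  ultimately show ?thesis using card_nb[of v] assms by simp
qed

text \<open>The initial charge is 30. A 2-neighbour is unique by \<open>poor_nb\<close>, so the
  outflow is 18 + 3 * 4 = 30 if there is one, and 4 * 5 = 20 otherwise.\<close>

lemma final_charge_four:
  assumes "deg v = 4"
  shows "33 * int (deg v) - 102 + (\<Sum>w\<in>nb v. flow w v) - (\<Sum>w\<in>nb v. flow v w) \<ge> 0"
proof -
  have "(\<Sum>w\<in>nb v. flow v w) \<le> 30"
  proof (cases "\<exists>x\<in>nb v. deg x = 2")
    case True
    then obtain x where x: "x \<in> nb v" "deg x = 2" by blast
    have "flow v w = 4" if "w \<in> nb v - {x}" for w
      using poor_nb[OF x(2) _ that] x(1) nb_sym[of x v] True assms by (simp add: flow_def)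
    then have "(\<Sum>w\<in>nb v - {x}. flow v w) = 12"
      using x card_nb[of v] assms finite_nb by simp
    moreover have "flow v x = 18" using assms x by (simp add: flow_def)
    ultimately show ?thesis using sum.remove[OF finite_nb x(1), of "flow v"] by simp
  next
    case False
    then have "flow v w = 5" if "w \<in> nb v" for w using that assms by (auto simp: flow_def)
    then show ?thesis using card_nb[of v] assms by simp
  qed
  moreover have "(\<Sum>w\<in>nb v. flow w v) \<ge> 0" by (simp add: sum_nonneg flow_nonneg)
  ultimately show ?thesis using assms by simp
qed

text \<open>The initial charge is -3, so a net gain of 3 is required; the cases follow the number of
  4-neighbours.\<close>

lemma final_charge_three:
  assumes v: "deg v = 3"
  shows "33 * int (deg v) - 102 + (\<Sum>w\<in>nb v. flow w v) - (\<Sum>w\<in>nb v. flow v w) \<ge> 0"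
proof -
  let ?B = "nb v - nb4 v"
  have sub: "nb4 v \<subseteq> nb v" by (auto simp: nb4_def)
  have B: "card ?B = 3 - card (nb4 v)"
    using card_Diff_subset[OF finite_nb4 sub] card_nb[of v] v by simp
  have "flow v w = 0" if "w \<in> nb4 v" for w using that v by (simp add: flow_def nb4_def)
  then have out: "(\<Sum>w\<in>nb v. flow v w) = (\<Sum>w\<in>?B. flow v w)"
    using sum.subset_diff[OF sub finite_nb, of "flow v"] by simp
  have inn: "(\<Sum>w\<in>nb4 v. flow w v) \<le> (\<Sum>w\<in>nb v. flow w v)"
    by (rule sum_mono2) (use sub finite_nb flow_nonneg in auto)
  consider "card (nb4 v) \<ge> 2" | "card (nb4 v) = 1" | "card (nb4 v) = 0" by linarith
  then have "(\<Sum>w\<in>nb v. flow w v) - (\<Sum>w\<in>nb v. flow v w) \<ge> 3"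
  proof cases
    case 1
    \<comment> \<open>With at least two 4-neighbours, at least 8 comes in and at most 3 leaves, to
      the one remaining neighbour if any.\<close>
    have "of_nat (card (nb4 v)) * 4 \<le> (\<Sum>w\<in>nb4 v. flow w v)"
      by (rule sum_bounded_below) (use v in \<open>auto simp: flow_def nb4_def\<close>)
    moreover have "(\<Sum>w\<in>?B. flow v w) \<le> of_nat (card ?B) * 3"
      by (rule sum_bounded_above) (use v in \<open>auto simp: flow_def\<close>)
    ultimately show ?thesis using 1 B out inn by linarith
  next
    case 2
    \<comment> \<open>If \<open>p\<close> has a 2-neighbour it sends 4, and at most one needy
      neighbour takes 1, by \<open>needy_pair_reducible\<close>. Otherwise \<open>p\<close> sends 5
      and at most two take 1.\<close>
    then obtain p where p: "nb4 v = {p}" by (auto simp: card_1_singleton_iff)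
    then have p4: "p \<in> nb v" "deg p = 4" by (auto simp: nb4_def)
    have le: "flow v w \<le> of_bool (needy w)" for w using 2 v by (auto simp: flow_def)
    have out2: "(\<Sum>w\<in>?B. flow v w) \<le> of_nat (card {w \<in> ?B. needy w})"
      using sum_mono[of ?B "flow v" "\<lambda>w. of_bool (needy w)"] le finite_nb by (simp add: Int_def)
    show ?thesis
    proof (cases "\<exists>x\<in>nb p. deg x = 2")
      case True
      then obtain x where x: "x \<in> nb p" "deg x = 2" by blast
      have "w = w'" if "w \<in> {w \<in> ?B. needy w}" "w' \<in> {w \<in> ?B. needy w}" for w w'
      proof (rule ccontr)
        assume "w \<noteq> w'"
        with needy_pair_reducible[of w v p x w'] that p4 x nb_sym[of v w] show False
          by (auto simp: needy_def)
      qed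
      then have "card {w \<in> ?B. needy w} \<le> Suc 0"
        using finite_nb by (subst card_le_Suc0_iff_eq) auto
      moreover have "flow p v = 4" using p4 v True by (simp add: flow_def)
      ultimately show ?thesis using out out2 inn p by simp
    next
      case False
      have "card {w \<in> ?B. needy w} \<le> card ?B" by (rule card_mono) (use finite_nb in auto)
      moreover have "flow p v = 5" using p4 v False by (simp add: flow_def)
      ultimately show ?thesis using out out2 inn p B 2 by simp
    qed
  next
    case 3
    then have n4: "nb4 v = {}" using finite_nb4 by simp
    \<comment> \<open>A needy neighbour would force \<open>v\<close> to have a 4-neighbour, so
      nothing leaves \<open>v\<close>.\<close>
    have "flow v w = 0" if "w \<in> nb v" for w
      using needy_nb(2)[of w v] that 3 v nb_sym[of v w] by (auto simp: flow_def)
    then have 0: "(\<Sum>w\<in>nb v. flow v w) = 0" by simp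
    have d3: "deg w = 3" if "w \<in> nb v" for w using three_nb[OF v that] n4 that by (auto simp: nb4_def)
    show ?thesis
    proof (cases "needy v")
      case True
      have "flow w v = 1" if "w \<in> nb v" for w
        using needy_nb(2)[OF True that] d3[OF that] v n4 True by (simp add: flow_def)
      then show ?thesis using 0 card_nb[of v] v by simp
    next
      case False
      then obtain w where w: "w \<in> nb v" "card (nb4 w) \<ge> 2" using v n4 by (auto simp: needy_def)
      then have "flow w v = 3" using d3 v n4 by (simp add: flow_def)
      then show ?thesis using 0 member_le_sum[OF w(1), of "\<lambda>w. flow w v"] finite_nb flow_nonneg by simp
    qed
  qed
  then show ?thesis using v by simp
qed

text \<open>Moving charge keeps the total, which is 66 times the number of edges minus 102 times the
  number of vertices; nonnegative final charges give the bound after division by 6.\<close>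

lemma edge_bound: "17 * card V \<le> 11 * card E"
proof -
  have "(\<Sum>v\<in>V. \<Sum>w\<in>nb v. flow w v) = (\<Sum>v\<in>V. \<Sum>w | w \<in> V \<and> w \<in> nb v. flow w v)"
    by (intro sum.cong refl) (use nb_in_V in blast)+
  also have "\<dots> = (\<Sum>w\<in>V. \<Sum>v | v \<in> V \<and> w \<in> nb v. flow w v)"
    by (rule sum.swap_restrict[OF finite_V finite_V])
  also have "\<dots> = (\<Sum>v\<in>V. \<Sum>w\<in>nb v. flow v w)"
    by (intro sum.cong refl) (use nb_in_V nb_sym in blast)+
  finally have "(\<Sum>v\<in>V. \<Sum>w\<in>nb v. flow w v) = (\<Sum>v\<in>V. \<Sum>w\<in>nb v. flow v w)" .
  moreover have "0 \<le> (\<Sum>v\<in>V. 33 * int (deg v) - 102 + (\<Sum>w\<in>nb v. flow w v) - (\<Sum>w\<in>nb v. flow v w))"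
    by (rule sum_nonneg) (use deg_cases final_charge_two final_charge_three final_charge_four in blast)
  ultimately have "0 \<le> (\<Sum>v\<in>V. 33 * int (deg v)) - 102 * int (card V)"
    by (simp add: sum.distrib sum_subtractf)
  also have "(\<Sum>v\<in>V. 33 * int (deg v)) = 66 * int (card E)"
    using sum_deg by (simp flip: sum_distrib_left of_nat_sum)
  finally show ?thesis by linarith
qed

end

section \<open>From minimal counterexamples to the theorem\<close>

text \<open>The density condition is put on induced subgraphs, so it survives deletion of vertices,
  as does the degree condition. A vertex-minimal failure is a \<open>critical_graph\<close>, and
  \<open>edge_bound\<close> contradicts the density of \<open>V\<close> itself.\<close>

lemma sparse_colorable:
  assumes "finite_simple_graph V E"
    and "\<And>v w. {v, w} \<in> E \<Longrightarrow> vertex_degree E v + vertex_degree E w \<le> 7"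
    and "\<And>S. S \<subseteq> V \<Longrightarrow> S \<noteq> {} \<Longrightarrow> 11 * card {e \<in> E. e \<subseteq> S} < 17 * card S"
  shows "\<exists>c. colors_on E E c"
  using assms
proof (induction "card V" arbitrary: V E rule: less_induct)
  case less
  interpret fin_graph V E by standard (fact less.prems(1))
  show ?case
  proof (rule ccontr)
    assume nc: "\<nexists>c. colors_on E E c"
    have del: "\<exists>c. colors_on E {e \<in> E. e \<inter> S = {}} c" if S: "S \<subseteq> V" "S \<noteq> {}" for S
    proof -
      let ?F = "{e \<in> E. e \<inter> S = {}}"
      have "card (V - S) < card V"
        by (rule psubset_card_mono) (use S finite_V in auto)
      moreover have "finite_simple_graph (V - S) ?F"
        unfolding finite_simple_graph_def simple_graph_def
      proof (intro conjI ballI)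
        fix e assume "e \<in> ?F"
        then show "e \<subseteq> V - S" "card e = 2" using edge_in[of e] edge_card[of e] by auto
      qed (simp add: finite_V)
      moreover have "vertex_degree ?F v + vertex_degree ?F w \<le> 7" if "{v, w} \<in> ?F" for v w
      proof -
        have le: "vertex_degree ?F x \<le> vertex_degree E x" for x
          unfolding vertex_degree_def by (rule card_mono) (use finite_E in auto)
        have "{v, w} \<in> E" using that by simp
        from less.prems(2)[OF this] show ?thesis using le[of v] le[of w] by linarith
      qed
      moreover have "11 * card {e \<in> ?F. e \<subseteq> T} < 17 * card T" if "T \<subseteq> V - S" "T \<noteq> {}" for T
      proof -
        have "{e \<in> ?F. e \<subseteq> T} = {e \<in> E. e \<subseteq> T}" using that by auto
        moreover have "T \<subseteq> V" using that(1) by blast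
        ultimately show ?thesis using less.prems(3)[OF _ that(2)] by simp
      qed
      ultimately obtain c where c: "colors_on ?F ?F c" using less.hyps by blast
      \<comment> \<open>An edge joining two surviving edges has its ends on them, so it avoids
        \<open>S\<close> and survives too. Hence deleting vertices destroys no visibility among the
        remaining edges.\<close>
      have "sees ?F e f" if "e \<in> ?F" "f \<in> ?F" "sees E e f" for e f
      proof -
        have ef: "e \<noteq> f" "e \<inter> f \<noteq> {} \<or> (\<exists>g\<in>E. g \<inter> e \<noteq> {} \<and> g \<inter> f \<noteq> {})"
          using that sees_iff[of e E f] by auto
        have "\<exists>g\<in>?F. g \<inter> e \<noteq> {} \<and> g \<inter> f \<noteq> {}" if dis: "e \<inter> f = {}"
        proof -
          obtain g s t where g: "g \<in> E" "s \<in> g" "t \<in> g" "s \<in> e" "t \<in> f" using ef(2) dis by blast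
          moreover obtain r where "g = {s, r}" using edge_ex[OF g(1,2)] .
          ultimately have "g = {s, t}" using dis by auto
          then have "g \<inter> S = {}" using g \<open>e \<in> ?F\<close> \<open>f \<in> ?F\<close> by auto
          then show ?thesis using g by blast
        qed
        then show ?thesis using sees_iff[OF \<open>e \<in> ?F\<close> \<open>f \<in> ?F\<close>] ef(1) by blast
      qed
      then have "colors_on E ?F c" using c unfolding colors_on_def by blast
      then show ?thesis by blast
    qed
    interpret critical_graph V E
      by standard (use less.prems(2) del nc in blast)+
    have "V \<noteq> {}"
    proof
      assume "V = {}"
      then have "E = {}" using edge_in edge_card by fastforce
      then show False using nc by (simp add: colors_on_def)
    qed
    moreover have "{e \<in> E. e \<subseteq> V} = E" using edge_in by blast
    ultimately show False using less.prems(3)[of V] edge_bound by simp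
  qed
qed

theorem theorem1:
  fixes V :: "'a set" and E :: "'a set set"
  assumes "finite_simple_graph V E"
    and "connected_graph V E"
    and "ore_degree E \<le> 7"
    and "max_avg_degree V E < 34 / 11"
  shows "strong_chromatic_index E \<le> 13"
proof -
  interpret fin_graph V E by standard (fact assms(1))
  have "vertex_degree E v + vertex_degree E w \<le> 7" if "{v, w} \<in> E" for v w
  proof -
    let ?D = "{vertex_degree E u + vertex_degree E v | u v. {u, v} \<in> E}"
    have "?D \<subseteq> (\<lambda>(u, v). vertex_degree E u + vertex_degree E v) ` (V \<times> V)"
      using edgeD by fastforce
    then have "finite ?D" by (rule finite_subset) (simp add: finite_V)
    then have "vertex_degree E v + vertex_degree E w \<le> Max ?D"
      by (rule Max_ge) (use that in blast)
    then show ?thesis using assms(3) that by (auto simp: ore_degree_def split: if_splits)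
  qed
  moreover have "11 * card {e \<in> E. e \<subseteq> S} < 17 * card S" if S: "S \<subseteq> V" "S \<noteq> {}" for S
  proof -
    let ?A = "{avg_degree V' E' | V' E'. is_subgraph V' E' V E \<and> V' \<noteq> {}}"
    let ?F = "{e \<in> E. e \<subseteq> S}"
    have "?A \<subseteq> (\<lambda>(V', E'). avg_degree V' E') ` (Pow V \<times> Pow E)"
      by (auto simp: is_subgraph_def)
    then have "finite ?A" by (rule finite_subset) (simp add: finite_V finite_E)
    moreover have "is_subgraph S ?F V E"
      using S edge_card by (auto simp: is_subgraph_def simple_graph_def)
    then have "avg_degree S ?F \<in> ?A" using S by blast
    ultimately have "avg_degree S ?F \<le> max_avg_degree V E"
      unfolding max_avg_degree_def by (rule Max_ge)
    then have "2 * real (card ?F) / real (card S) < 34 / 11"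
      using assms(4) by (simp add: avg_degree_def)
    moreover have "card S > 0" using S finite_V finite_subset card_gt_0_iff by metis
    ultimately have "real (11 * card ?F) < real (17 * card S)" by (simp add: field_simps)
    then show ?thesis by linarith
  qed
  ultimately obtain c where c: "colors_on E E c"
    using sparse_colorable[OF assms(1)] by blast
  have "c ` E \<subseteq> {..<13}" using c by (auto simp: colors_on_def)
  then have "card (c ` E) \<le> 13" using card_mono[of "{..<13::nat}"] by simp
  moreover have "strong_chromatic_index E \<le> card (c ` E)"
    unfolding strong_chromatic_index_def
    by (rule Least_le) (use c in \<open>auto simp: colors_on_def strong_edge_coloring_def\<close>)
  ultimately show ?thesis by simp
qed

end
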